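(* Let $H$ be a separable infinite-dimensional Hilbert space and let $(f_n)_{n=1}^\infty$ be a Parseval frame for $H$ such that $e((f_n)_{n=1}^\infty)<\infty$. Then for each $\epsilon>0$ there exists $n_0\in\mathbb N$ such that for each subset $J$ of $\mathbb N$ with the property $\{1,2,\ldots,n_0\}\subseteq J$ we have $$\sum_{n\in J}|\langle x,f_n\rangle|^2+\left\|\sum_{n\in\mathbb N\setminus J}\langle x,f_n\rangle f_n\right\|^2>(1-\epsilon)\|x\|^2,\quad\forall x\in H\setminus\{0\},$$ and $$\sum_{n\in\mathbb N\setminus J}|\langle x,f_n\rangle|^2+\left\|\sum_{n\in J}\langle x,f_n\rangle f_n\right\|^2>(1-\epsilon)\|x\|^2,\quad\forall x\in H\setminus\{0\}.$$
   Context: $\mathbb N=\{1,2,3,\ldots\}$. A sequence $(f_n)_{n=1}^\infty$ in $H$ is a Parseval frame if $\sum_{n=1}^\infty|\langle x,f_n\rangle|^2=\|x\|^2$ for all $x\in H$. The excess $e((f_n)_{n=1}^\infty)$ of a frame is the greatest integer $k$ such that some $k$ elements can be deleted from the frame and still leave a complete set (a set whose closed linear span is $H$), or $+\infty$ if there is no upper bound to the number of elements that can be removed. *)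

theory Defs
  imports "HOL-Analysis.Analysis" "Jordan_Normal_Form.Conjugate"
begin

text \<open>
  The scalar field of a Hilbert space is the reals or the complex numbers. Both are covered by one
  class; by the Gelfand--Mazur theorem there are no further instances up to isomorphism.
\<close>

class hilbert_scalar = real_normed_field + conjugatable_field +
  assumes mult_conjugate: "z * conjugate z = (norm z)\<^sup>2 *\<^sub>R 1"

instance real :: hilbert_scalar
  by standard (simp add: power2_eq_square)

instance complex :: hilbert_scalar
  by standard (simp add: complex_norm_square[symmetric] scaleR_conv_of_real)

text \<open>
  A Hilbert space over \<open>'k\<close> on the type \<open>'a\<close>. The class \<^class>\<open>banach\<close> supplies
  the norm and its completeness; the norm is required to be the one induced by \<open>ip\<close>, and \<open>smul\<close>
  has to extend the real scalar multiplication of \<open>'a\<close>. The inner product is linear in its first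
  argument.
\<close>

locale hilbert_space = vector_space smul
  for smul :: "'k::hilbert_scalar \<Rightarrow> 'a::banach \<Rightarrow> 'a" +
  fixes ip :: "'a \<Rightarrow> 'a \<Rightarrow> 'k"
  assumes smul_of_real: "smul (of_real r) x = r *\<^sub>R x"
    and ip_add_left: "ip (x + y) z = ip x z + ip y z"
    and ip_smul_left: "ip (smul c x) y = c * ip x y"
    and ip_conjugate: "ip y x = conjugate (ip x y)"
    and ip_self: "ip x x = of_real ((norm x)\<^sup>2)"

lemma hilbert_space_real_inner:
  "hilbert_space (*\<^sub>R) ((\<bullet>) :: 'a::{real_inner, banach} \<Rightarrow> 'a \<Rightarrow> real)"
  by unfold_locales
    (auto simp: algebra_simps inner_commute power2_norm_eq_inner)

lemma hilbert_space_complex: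
  "hilbert_space (*) (\<lambda>x y :: complex. x * cnj y)"
  by unfold_locales (simp_all add: distrib_left distrib_right scaleR_conv_of_real complex_norm_square[symmetric])

definition infinite_dimensional :: "('k::field \<Rightarrow> 'a::ab_group_add \<Rightarrow> 'a) \<Rightarrow> bool" where
  "infinite_dimensional smul \<longleftrightarrow> \<not> (\<exists>B. finite B \<and> module.span smul B = UNIV)"

definition complete_set ::
    "('k::field \<Rightarrow> 'a::{ab_group_add, topological_space} \<Rightarrow> 'a) \<Rightarrow> 'a set \<Rightarrow> bool" where
  "complete_set smul S \<longleftrightarrow> closure (module.span smul S) = UNIV"

text \<open>
  Sequences are indexed by \<open>{1..}\<close>; the value at \<open>0\<close> is never used.
\<close>

definition parseval_frame :: "('a::real_normed_vector \<Rightarrow> 'a \<Rightarrow> 'k::real_normed_vector) \<Rightarrow> (nat \<Rightarrow> 'a) \<Rightarrow> bool" where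
  "parseval_frame ip f \<longleftrightarrow>
     (\<forall>x. ((\<lambda>n. (norm (ip x (f n)))\<^sup>2) has_sum (norm x)\<^sup>2) {1..})"

text \<open>
  Elements are deleted by index, so repeated vectors count separately. In \<^typ>\<open>enat\<close> the supremum is
  the maximum if the numbers of deletable elements are bounded, and \<open>\<infinity>\<close> otherwise.
\<close>

definition excess ::
    "('k::field \<Rightarrow> 'a::{ab_group_add, topological_space} \<Rightarrow> 'a) \<Rightarrow> (nat \<Rightarrow> 'a) \<Rightarrow> enat" where
  "excess smul f =
     Sup {enat (card D) | D. finite D \<and> D \<subseteq> {1..} \<and> complete_set smul (f ` ({1..} - D))}"

end

theory Submission
  imports Defs
begin

text \<open>
  Let \<open>c n = \<langle>x, f n\<rangle>\<close>, let \<open>K\<close> be the complement of \<open>J\<close>, and let \<open>u\<close> and \<open>v = x - u\<close> be the sums of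
  \<open>c n f n\<close> over \<open>K\<close> and over \<open>J\<close>. Write \<open>A\<close> and \<open>B\<close> for the sums of \<open>|c n|\<^sup>2\<close> over \<open>J\<close> and \<open>K\<close>. Since
  \<open>\<langle>u, x\<rangle> = B\<close>, expanding \<open>\<parallel>x - u\<parallel>\<^sup>2\<close> shows that both expressions of the theorem have the same value,
  namely \<open>\<parallel>x\<parallel>\<^sup>2 - (B - \<parallel>u\<parallel>\<^sup>2)\<close>. What has to be shown is that the defect \<open>B - \<parallel>u\<parallel>\<^sup>2 = \<langle>u, x - u\<rangle>\<close> is small
  compared with \<open>\<parallel>x\<parallel>\<^sup>2\<close> as soon as \<open>K\<close> is far out, uniformly in \<open>x\<close> and \<open>K\<close>.

  The defect measures how far \<open>c\<close>, cut off to \<open>K\<close>, is from being a sequence of frame coefficients.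
  The sequence \<open>r n = c n [n \<in> K] - \<langle>u, f n\<rangle>\<close> is square summable and satisfies
  \<open>(\<Sum>n. r n f n) = u - u = 0\<close>: it is a relation among the frame vectors. Also
  \<open>r n = \<langle>x - u, f n\<rangle>\<close> for \<open>n \<in> K\<close>, so the defect is the sum of \<open>c n\<close> times the conjugate of \<open>r n\<close>
  over \<open>n \<in> K\<close>.

  Finite excess makes the space of relations finite-dimensional. If a finite set \<open>D\<close> of indices has a
  dual family of relations, that is, relations \<open>C d\<close> with entry \<open>1\<close> at \<open>d\<close> and \<open>0\<close> elsewhere on \<open>D\<close>, then every
  expansion \<open>x = (\<Sum>n. a n f n)\<close> can be corrected by a combination of the \<open>C d\<close> so that it avoids
  \<open>D\<close>; hence \<open>D\<close> can be deleted and \<open>|D|\<close> is at most the excess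
  (\<open>dual_relations_imp_complete\<close>). For a \<open>D\<close> of maximal size no nonzero relation vanishes on
  \<open>D\<close>, so \<open>r n = (\<Sum>d\<in>D. r d C d n)\<close> for every relation \<open>r\<close>
  (\<open>finite_excess_imp_relations_determined\<close>).

  If \<open>K\<close> is disjoint from \<open>D\<close>, then \<open>|r d| \<le> \<parallel>u\<parallel> \<le> \<parallel>x\<parallel>\<close> for \<open>d \<in> D\<close>, and the Cauchy-Schwarz inequality
  bounds the defect by \<open>\<parallel>x\<parallel>\<^sup>2\<close> times the sum over \<open>d \<in> D\<close> of the square-sum norms of \<open>C d\<close> on
  \<open>K\<close> (\<open>defect_bound\<close>). These finitely many tails tend to \<open>0\<close>, at a rate that depends only on
  the frame.
\<close>

section \<open>Unordered sums\<close>

text \<open>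
  A series with square-summable coefficients in a frame need not converge absolutely. A bound on the
  squared norms of finite partial sums by those of a convergent real sum still makes the net of
  partial sums a Cauchy net.
\<close>

lemma summable_on_of_square_bound:
  fixes h :: "'i \<Rightarrow> 'b::banach" and g :: "'i \<Rightarrow> real"
  assumes "g summable_on A"
    and bound: "\<And>F. finite F \<Longrightarrow> F \<subseteq> A \<Longrightarrow> (norm (sum h F))\<^sup>2 \<le> sum g F"
  shows "h summable_on A"
proof -
  obtain L where lim: "(sum g \<longlongrightarrow> L) (finite_subsets_at_top A)"
    using assms(1) unfolding has_sum_def summable_on_def by blast
  have "\<exists>P. eventually P (finite_subsets_at_top A) \<and>
            (\<forall>F F'. P F \<and> P F' \<longrightarrow> dist (sum h F) (sum h F') < e)" if "e > 0" for e
  proof -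
    \<comment> \<open>Partial sums of \<open>g\<close> within \<open>d\<close> of \<open>L\<close> differ by less than \<open>2 * d\<close>, which is below
      \<open>(e / 2)\<^sup>2\<close>; so those of \<open>h\<close> differ by less than \<open>e / 2\<close>.\<close>
    define d where "d = e\<^sup>2 / 16"
    have "d > 0" using that by (simp add: d_def)
    have "eventually (\<lambda>F. dist (sum g F) L < d) (finite_subsets_at_top A)"
      using lim \<open>d > 0\<close> by (simp add: tendsto_iff)
    then obtain F\<^sub>0 where F\<^sub>0: "finite F\<^sub>0" "F\<^sub>0 \<subseteq> A"
      and near: "\<forall>F. finite F \<and> F\<^sub>0 \<subseteq> F \<and> F \<subseteq> A \<longrightarrow> dist (sum g F) L < d"
      unfolding eventually_finite_subsets_at_top by blast
    define P where "P F \<longleftrightarrow> finite F \<and> F\<^sub>0 \<subseteq> F \<and> F \<subseteq> A" for F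
    have close: "dist (sum h F) (sum h F\<^sub>0) < e / 2" if "P F" for F
    proof -
      have F: "finite F" "F\<^sub>0 \<subseteq> F" "F \<subseteq> A" using that by (auto simp: P_def)
      have "(dist (sum h F) (sum h F\<^sub>0))\<^sup>2 = (norm (sum h (F - F\<^sub>0)))\<^sup>2"
        using F by (simp add: dist_norm sum_diff)
      also have "\<dots> \<le> sum g (F - F\<^sub>0)" using F by (intro bound) auto
      also have "\<dots> = sum g F - sum g F\<^sub>0" using F by (simp add: sum_diff)
      also have "\<dots> < 2 * d"
        using near[rule_format, of F] near[rule_format, of F\<^sub>0] F F\<^sub>0 unfolding dist_real_def by auto
      also have "\<dots> \<le> (e / 2)\<^sup>2" using \<open>e > 0\<close> by (simp add: d_def power_divide)
      finally show ?thesis by (rule power_less_imp_less_base) (use \<open>e > 0\<close> in simp)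
    qed
    have "eventually P (finite_subsets_at_top A)"
      unfolding eventually_finite_subsets_at_top P_def using F\<^sub>0 by blast
    moreover have "dist (sum h F) (sum h F') < e" if "P F" "P F'" for F F'
      using dist_triangle2[of "sum h F" "sum h F'" "sum h F\<^sub>0"] close[OF that(1)] close[OF that(2)]
      by linarith
    ultimately show ?thesis by blast
  qed
  then have "cauchy_filter (filtermap (sum h) (finite_subsets_at_top A))"
    by (simp add: cauchy_filter_metric_filtermap)
  moreover have "complete (UNIV::'b set)"
    by (rule complete_UNIV)
  ultimately obtain L' where "(sum h \<longlongrightarrow> L') (finite_subsets_at_top A)"
    using complete_uniform[where S=UNIV] by (force simp add: filterlim_def)
  then show ?thesis
    using summable_on_def has_sum_def by blast
qed

lemma has_sum_norm_le:
  fixes h :: "'i \<Rightarrow> 'b::real_normed_vector"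
  assumes "(h has_sum s) A"
    and "\<And>F. finite F \<Longrightarrow> F \<subseteq> A \<Longrightarrow> norm (sum h F) \<le> b"
  shows "norm s \<le> b"
proof (rule tendsto_upperbound)
  show "((\<lambda>F. norm (sum h F)) \<longlongrightarrow> norm s) (finite_subsets_at_top A)"
    using assms(1) unfolding has_sum_def by (rule tendsto_norm)
  show "\<forall>\<^sub>F F in finite_subsets_at_top A. norm (sum h F) \<le> b"
    by (rule eventually_finite_subsets_at_top_weakI) (rule assms(2))
qed simp

lemma tail_sum_less:
  fixes g :: "nat \<Rightarrow> real"
  assumes "g summable_on {1..}" and "\<And>n. g n \<ge> 0" and "e > 0"
  obtains N where "\<And>K. K \<subseteq> {Suc N..} \<Longrightarrow> infsum g K < e"
proof -
  obtain F where F: "finite F" "F \<subseteq> {1..}" "dist (sum g F) (infsum g {1..}) \<le> e / 2"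
    using infsum_finite_approximation[OF assms(1), of "e / 2"] \<open>e > 0\<close> by auto
  define N where "N = Max (insert 0 F)"
  show thesis
  proof (rule that)
    fix K assume K: "K \<subseteq> {Suc N..}"
    have disj: "K \<inter> F = {}"
    proof (rule ccontr)
      assume "K \<inter> F \<noteq> {}"
      then obtain n where "n \<in> K" "n \<in> F" by blast
      moreover have "n \<le> N" unfolding N_def using F(1) \<open>n \<in> F\<close> by (intro Max_ge) auto
      ultimately show False using K by auto
    qed
    have K1: "K \<subseteq> {1..}" using K by auto
    have gK: "g summable_on K" using assms(1) K1 by (rule summable_on_subset_banach)
    have "infsum g K + sum g F = infsum g (K \<union> F)"
      using infsum_Un_disjoint[OF gK _ disj] F(1) by simp
    also have "\<dots> \<le> infsum g {1..}"
      by (rule infsum_mono2[OF summable_on_subset_banach[OF assms(1)] assms(1)])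
        (use F K1 assms in auto)
    finally show "infsum g K < e" using F(3) \<open>e > 0\<close> unfolding dist_real_def by linarith
  qed
qed

lemma sum_norm_mult_le:
  fixes a b :: "'i \<Rightarrow> 'k::real_normed_vector"
  assumes "(\<Sum>i\<in>F. (norm (a i))\<^sup>2) \<le> p\<^sup>2" "(\<Sum>i\<in>F. (norm (b i))\<^sup>2) \<le> q\<^sup>2" "p \<ge> 0" "q \<ge> 0"
  shows "(\<Sum>i\<in>F. norm (a i) * norm (b i)) \<le> p * q"
proof (rule power2_le_imp_le)
  have "(\<Sum>i\<in>F. norm (a i) * norm (b i))\<^sup>2
      \<le> (\<Sum>i\<in>F. (norm (a i))\<^sup>2) * (\<Sum>i\<in>F. (norm (b i))\<^sup>2)"
    by (rule Cauchy_Schwarz_ineq_sum)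
  also have "\<dots> \<le> p\<^sup>2 * q\<^sup>2"
    by (rule mult_mono) (use assms in \<open>auto intro: sum_nonneg\<close>)
  finally show "(\<Sum>i\<in>F. norm (a i) * norm (b i))\<^sup>2 \<le> (p * q)\<^sup>2" by (simp add: power_mult_distrib)
qed (use assms in simp)

lemma summable_on_norm_sq_diff:
  fixes a b :: "'i \<Rightarrow> 'k::real_normed_vector"
  assumes "(\<lambda>n. (norm (a n))\<^sup>2) summable_on A" "(\<lambda>n. (norm (b n))\<^sup>2) summable_on A"
  shows "(\<lambda>n. (norm (a n - b n))\<^sup>2) summable_on A"
proof -
  have le: "(norm (a n - b n))\<^sup>2 \<le> 2 * (norm (a n))\<^sup>2 + 2 * (norm (b n))\<^sup>2" for n
  proof -
    have "(norm (a n - b n))\<^sup>2 \<le> (norm (a n) + norm (b n))\<^sup>2"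
      by (rule power_mono[OF norm_triangle_ineq4]) simp
    also have "\<dots> \<le> 2 * (norm (a n))\<^sup>2 + 2 * (norm (b n))\<^sup>2"
      using sum_squares_bound[of "norm (a n)" "norm (b n)"] by (simp add: power2_sum)
    finally show ?thesis .
  qed
  have "(\<lambda>n. 2 * (norm (a n))\<^sup>2 + 2 * (norm (b n))\<^sup>2) summable_on A"
    by (intro summable_on_add summable_on_cmult_right assms)
  then show ?thesis
    by (rule summable_on_comparison_test) (use le in auto)
qed

section \<open>Inner products over the abstract scalar field\<close>

lemma conjugate_of_real [simp]: "conjugate (of_real r :: 'k::hilbert_scalar) = of_real r"
proof (cases "r = 0")
  case False
  have "of_real r * conjugate (of_real r :: 'k) = of_real r * of_real r"
    by (simp add: mult_conjugate scaleR_conv_of_real power2_eq_square)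
  then show ?thesis using False by simp
qed simp

lemma norm_conjugate [simp]: "norm (conjugate (z :: 'k::hilbert_scalar)) = norm z"
proof (cases "z = 0")
  case False
  have "norm z * norm (conjugate z) = norm (z * conjugate z)" by (simp add: norm_mult)
  also have "\<dots> = norm z * norm z" by (simp add: mult_conjugate power2_eq_square)
  finally show ?thesis using False by simp
qed simp

lemma mult_conjugate_of_real: "(z :: 'k::hilbert_scalar) * conjugate z = of_real ((norm z)\<^sup>2)"
  by (simp add: mult_conjugate scaleR_conv_of_real)

context hilbert_space
begin

lemma ip_add_right: "ip x (y + z) = ip x y + ip x z"
  using ip_conjugate[of x "y + z"] ip_conjugate[of x y] ip_conjugate[of x z]
  by (simp only: ip_add_left conjugate_dist_add)

lemma ip_smul_right: "ip x (smul c y) = conjugate c * ip x y"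
  using ip_conjugate[of x "smul c y"] ip_conjugate[of x y]
  by (simp only: ip_smul_left conjugate_dist_mul)

lemma ip_diff_left: "ip (x - y) z = ip x z - ip y z"
  using ip_add_left[of "x - y" y z] by simp

lemma ip_diff_right: "ip x (y - z) = ip x y - ip x z"
  using ip_add_right[of x "y - z" z] by simp

lemma norm_ip_commute: "norm (ip y x) = norm (ip x y)"
  using norm_conjugate[of "ip x y"] by (simp only: ip_conjugate[of y x])

lemma norm_diff_square:
  "of_real ((norm (x - y))\<^sup>2) = of_real ((norm x)\<^sup>2) - ip x y - ip y x + (of_real ((norm y)\<^sup>2) :: 'k)"
  unfolding ip_self[symmetric] by (simp add: ip_diff_left ip_diff_right)

lemma norm_smul: "norm (smul c x) = norm c * norm x"
proof -
  have "of_real ((norm (smul c x))\<^sup>2) = ip (smul c x) (smul c x)" by (simp add: ip_self)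
  also have "\<dots> = c * conjugate c * ip x x" by (simp add: ip_smul_left ip_smul_right)
  also have "\<dots> = of_real ((norm c * norm x)\<^sup>2)"
    by (simp add: mult_conjugate_of_real ip_self power_mult_distrib)
  finally have "(norm (smul c x))\<^sup>2 = (norm c * norm x)\<^sup>2" using of_real_eq_iff by blast
  then show ?thesis by (simp add: power2_eq_iff_nonneg)
qed

text \<open>
  The scalar field carries no real part, so the expansion of the nonnegative number
  \<open>\<parallel>x - c y\<parallel>\<^sup>2\<close> is carried out inside the field. With \<open>c y\<close> the projection of \<open>x\<close> onto \<open>y\<close> all its
  terms are embedded reals, and the embedding is injective.
\<close>

lemma Cauchy_Schwarz: "norm (ip x y) \<le> norm x * norm y"
proof (cases "y = 0")
  case True
  then show ?thesis using ip_diff_right[of x y y] by simp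
next
  case False
  define c where "c = ip x y / of_real ((norm y)\<^sup>2)"
  have ny: "norm y > 0" using False by simp
  have c1: "conjugate c * ip x y = of_real ((norm (ip x y))\<^sup>2 / (norm y)\<^sup>2)"
  proof -
    have "c * of_real ((norm y)\<^sup>2) = ip x y" using ny by (simp add: c_def)
    then have "conjugate (ip x y) = conjugate c * of_real ((norm y)\<^sup>2)"
      using conjugate_dist_mul[of c "of_real ((norm y)\<^sup>2)"] by (simp only: conjugate_of_real)
    then have "conjugate c * ip x y * of_real ((norm y)\<^sup>2) = ip x y * conjugate (ip x y)"
      by (simp only: mult_ac)
    then show ?thesis using ny by (simp add: mult_conjugate_of_real field_simps)
  qed
  have c2: "c * ip y x = of_real ((norm (ip x y))\<^sup>2 / (norm y)\<^sup>2)"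
    using mult_conjugate_of_real[of "ip x y"] by (simp add: c_def ip_conjugate[of y x])
  have nc: "norm c = norm (ip x y) / (norm y)\<^sup>2" by (simp add: c_def norm_divide norm_power)
  have "of_real ((norm (x - smul c y))\<^sup>2) =
      of_real ((norm x)\<^sup>2) - conjugate c * ip x y - c * ip y x + (of_real ((norm c * norm y)\<^sup>2) :: 'k)"
    by (subst norm_diff_square) (simp add: ip_smul_left ip_smul_right norm_smul)
  also have "\<dots> = of_real ((norm x)\<^sup>2 - (norm (ip x y))\<^sup>2 / (norm y)\<^sup>2)"
    unfolding c1 c2 nc using ny
    by (simp add: power_mult_distrib power_divide power2_eq_square)
  finally have "(norm (x - smul c y))\<^sup>2 = (norm x)\<^sup>2 - (norm (ip x y))\<^sup>2 / (norm y)\<^sup>2"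
    using of_real_eq_iff by blast
  then have "(norm (ip x y))\<^sup>2 / (norm y)\<^sup>2 \<le> (norm x)\<^sup>2"
    using zero_le_power2[of "norm (x - smul c y)"] by linarith
  then have "(norm (ip x y))\<^sup>2 \<le> (norm x * norm y)\<^sup>2"
    using ny by (simp add: field_simps)
  then show ?thesis by (rule power2_le_imp_le) simp
qed

lemma ip_scaleR_left: "ip (r *\<^sub>R x) y = r *\<^sub>R ip x y"
  using ip_smul_left[of "of_real r" x y] by (simp only: smul_of_real scaleR_conv_of_real)

lemma bounded_linear_ip: "bounded_linear (\<lambda>x. ip x y)"
  by (rule bounded_linear_intro[where K="norm y"])
    (simp_all add: ip_add_left ip_scaleR_left Cauchy_Schwarz)

lemma bounded_linear_smul: "bounded_linear (smul c)"
proof (rule bounded_linear_intro[where K="norm c"])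
  show "smul c (r *\<^sub>R x) = r *\<^sub>R smul c x" for r x
    by (simp only: smul_of_real[symmetric] scale_scale mult.commute)
qed (simp_all add: scale_right_distrib norm_smul mult.commute)

end

section \<open>Analysis and synthesis for a Parseval frame\<close>

locale parseval_frame_space = hilbert_space smul ip
  for smul :: "'k::hilbert_scalar \<Rightarrow> 'a::banach \<Rightarrow> 'a" and ip :: "'a \<Rightarrow> 'a \<Rightarrow> 'k" +
  fixes f :: "nat \<Rightarrow> 'a"
  assumes parseval: "parseval_frame ip f"
begin

lemma analysis_has_sum: "((\<lambda>n. (norm (ip x (f n)))\<^sup>2) has_sum (norm x)\<^sup>2) {1..}"
  using parseval unfolding parseval_frame_def by blast

text \<open>
  Synthesis is the adjoint of the isometric analysis map, hence a contraction: the Cauchy-Schwarz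
  inequality bounds \<open>\<parallel>u\<parallel>\<^sup>2 = (\<Sum>n\<in>F. c n * \<langle>f n, u\<rangle>)\<close> by the norm of \<open>c\<close> times that of the coefficients of
  \<open>u\<close>, and the latter is at most \<open>\<parallel>u\<parallel>\<close>.
\<close>

lemma synthesis_finite_bound:
  assumes "finite F" "F \<subseteq> {1..}"
  shows "(norm (\<Sum>n\<in>F. smul (c n) (f n)))\<^sup>2 \<le> (\<Sum>n\<in>F. (norm (c n))\<^sup>2)"
proof -
  define u where "u = (\<Sum>n\<in>F. smul (c n) (f n))"
  define s where "s = sqrt (\<Sum>n\<in>F. (norm (c n))\<^sup>2)"
  have s: "s\<^sup>2 = (\<Sum>n\<in>F. (norm (c n))\<^sup>2)" "s \<ge> 0" by (simp_all add: s_def sum_nonneg)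
  have "of_real ((norm u)\<^sup>2) = ip u u" by (simp add: ip_self)
  also have "\<dots> = (\<Sum>n\<in>F. c n * ip (f n) u)"
    using linear_sum[OF bounded_linear.linear[OF bounded_linear_ip[of u]],
        of "\<lambda>n. smul (c n) (f n)" F]
    by (simp only: u_def[symmetric] ip_smul_left)
  finally have "(norm u)\<^sup>2 = norm (\<Sum>n\<in>F. c n * ip (f n) u)"
    using norm_of_real[of "(norm u)\<^sup>2", where 'a='k] by (simp del: of_real_power)
  also have "\<dots> \<le> (\<Sum>n\<in>F. norm (c n) * norm (ip u (f n)))"
    using norm_sum[of "\<lambda>n. c n * ip (f n) u" F] by (simp only: norm_mult norm_ip_commute[of "f _" u])
  also have "\<dots> \<le> s * norm u"
    by (rule sum_norm_mult_le)
      (use s assms finite_sum_le_has_sum[OF analysis_has_sum[of u] assms] in auto)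
  finally have "norm u * norm u \<le> s * norm u" by (simp add: power2_eq_square)
  then have "norm u \<le> s" using s(2) by (cases "u = 0") auto
  then have "(norm u)\<^sup>2 \<le> s\<^sup>2" by (simp add: power_mono)
  then show ?thesis unfolding s(1) u_def .
qed

lemma synthesis_summable:
  assumes "(\<lambda>n. (norm (c n))\<^sup>2) summable_on A" "A \<subseteq> {1..}"
  shows "(\<lambda>n. smul (c n) (f n)) summable_on A"
  by (rule summable_on_of_square_bound[OF assms(1)])
    (use assms(2) in \<open>blast intro: synthesis_finite_bound\<close>)

lemma synthesis_bound:
  assumes "((\<lambda>n. (norm (c n))\<^sup>2) has_sum s) A" "((\<lambda>n. smul (c n) (f n)) has_sum u) A" "A \<subseteq> {1..}"
  shows "(norm u)\<^sup>2 \<le> s"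
proof -
  have s0: "s \<ge> 0" by (rule has_sum_nonneg[OF assms(1)]) simp
  have "norm u \<le> sqrt s"
  proof (rule has_sum_norm_le[OF assms(2)])
    fix F assume F: "finite F" "F \<subseteq> A"
    have "(norm (\<Sum>n\<in>F. smul (c n) (f n)))\<^sup>2 \<le> (\<Sum>n\<in>F. (norm (c n))\<^sup>2)"
      using F assms(3) by (intro synthesis_finite_bound) auto
    also have "\<dots> \<le> s" using F by (intro finite_sum_le_has_sum[OF assms(1)]) auto
    finally show "norm (\<Sum>n\<in>F. smul (c n) (f n)) \<le> sqrt s" by (rule real_le_rsqrt)
  qed
  then have "(norm u)\<^sup>2 \<le> (sqrt s)\<^sup>2" by (rule power_mono) simp
  then show ?thesis using s0 by simp
qed

lemma ip_synthesis:
  assumes "((\<lambda>n. smul (c n) (f n)) has_sum u) A"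
  shows "((\<lambda>n. c n * conjugate (ip x (f n))) has_sum ip u x) A"
proof -
  have "((\<lambda>n. ip (smul (c n) (f n)) x) has_sum ip u x) A"
    by (rule has_sum_bounded_linear[OF bounded_linear_ip assms])
  moreover have "ip (smul (c n) (f n)) x = c n * conjugate (ip x (f n))" for n
    unfolding ip_smul_left by (subst ip_conjugate) (rule refl)
  ultimately show ?thesis by (simp only:)
qed

lemma ip_synthesis_analysis:
  assumes "((\<lambda>n. (norm (ip x (f n)))\<^sup>2) has_sum s) A"
    and "((\<lambda>n. smul (ip x (f n)) (f n)) has_sum u) A"
  shows "ip u x = of_real s" "ip x u = of_real s"
proof -
  have "((\<lambda>n. of_real ((norm (ip x (f n)))\<^sup>2)) has_sum (of_real s :: 'k)) A"
    using assms(1) by (rule has_sum_of_real)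
  then show "ip u x = of_real s"
    using ip_synthesis[OF assms(2), of x]
    by (simp add: mult_conjugate_of_real has_sum_unique)
  then show "ip x u = of_real s" by (simp add: ip_conjugate[of x u])
qed

text \<open>
  With \<open>y\<close> the sum of the series, \<open>\<langle>y, x\<rangle> = \<parallel>x\<parallel>\<^sup>2\<close> because the frame is Parseval, and \<open>\<parallel>y\<parallel> \<le> \<parallel>x\<parallel>\<close> because
  synthesis is a contraction. So \<open>\<parallel>x - y\<parallel>\<^sup>2 = \<parallel>y\<parallel>\<^sup>2 - \<parallel>x\<parallel>\<^sup>2 \<le> 0\<close>. This argument avoids polarization,
  which takes different forms over the real and the complex numbers.
\<close>

lemma reconstruction: "((\<lambda>n. smul (ip x (f n)) (f n)) has_sum x) {1..}"
proof -
  define y where "y = (\<Sum>\<^sub>\<infinity>n\<in>{1..}. smul (ip x (f n)) (f n))"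
  have y: "((\<lambda>n. smul (ip x (f n)) (f n)) has_sum y) {1..}"
    unfolding y_def using analysis_has_sum
    by (intro has_sum_infsum synthesis_summable) (auto simp: summable_on_def)
  have "(of_real ((norm (x - y))\<^sup>2) :: 'k) = of_real ((norm y)\<^sup>2 - (norm x)\<^sup>2)"
    by (subst norm_diff_square) (simp add: ip_synthesis_analysis[OF analysis_has_sum y])
  then have "(norm (x - y))\<^sup>2 = (norm y)\<^sup>2 - (norm x)\<^sup>2" using of_real_eq_iff by blast
  moreover have "(norm y)\<^sup>2 \<le> (norm x)\<^sup>2" by (rule synthesis_bound[OF analysis_has_sum y]) simp
  ultimately have "(norm (x - y))\<^sup>2 \<le> 0" by linarith
  then have "x = y" by simp
  then show ?thesis using y by simp
qed

section \<open>Relations among the frame vectors and the excess\<close>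

text \<open>
  The relations are the kernel of the synthesis operator on square-summable sequences, which is the
  orthogonal complement of the range of the analysis operator.
\<close>

definition relation :: "(nat \<Rightarrow> 'k) \<Rightarrow> bool" where
  "relation c \<longleftrightarrow> (\<lambda>n. (norm (c n))\<^sup>2) summable_on {1..} \<and>
     ((\<lambda>n. smul (c n) (f n)) has_sum 0) {1..}"

lemma relation_zero: "relation (\<lambda>_. 0)"
  by (simp add: relation_def)

lemma relation_diff:
  assumes "relation c" "relation c'"
  shows "relation (\<lambda>n. c n - c' n)"
proof -
  have "((\<lambda>n. smul (c n) (f n) + - smul (c' n) (f n)) has_sum 0 + - 0) {1..}"
    using assms unfolding relation_def by (intro has_sum_add has_sum_uminus[THEN iffD2]) auto
  then show ?thesis using assms unfolding relation_def
    by (auto simp: scale_left_diff_distrib intro: summable_on_norm_sq_diff)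
qed

lemma relation_scale:
  assumes "relation c"
  shows "relation (\<lambda>n. a * c n)"
proof -
  have "((\<lambda>n. smul a (smul (c n) (f n))) has_sum smul a 0) {1..}"
    using assms unfolding relation_def by (intro has_sum_bounded_linear[OF bounded_linear_smul]) blast
  moreover have "(\<lambda>n. (norm a)\<^sup>2 * (norm (c n))\<^sup>2) summable_on {1..}"
    using assms unfolding relation_def by (intro summable_on_cmult_right) blast
  ultimately show ?thesis by (simp add: relation_def norm_mult power_mult_distrib)
qed

lemma relation_sub_combination:
  assumes "relation c" "finite D" "\<And>d. d \<in> D \<Longrightarrow> relation (C d)"
  shows "relation (\<lambda>n. c n - (\<Sum>d\<in>D. a d * C d n))"
  using assms(2,3)
proof (induction D rule: finite_induct)
  case empty
  then show ?case using assms(1) by simp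
next
  case (insert e D)
  have "relation (\<lambda>n. (c n - (\<Sum>d\<in>D. a d * C d n)) - a e * C e n)"
    using insert.IH insert.prems
    by (intro relation_diff[of "\<lambda>n. c n - (\<Sum>d\<in>D. a d * C d n)"] relation_scale) auto
  moreover have "(c n - (\<Sum>d\<in>D. a d * C d n)) - a e * C e n
      = c n - (\<Sum>d\<in>insert e D. a d * C d n)" for n
    using insert(1,2) by simp
  ultimately show ?case by simp
qed

text \<open>
  Such a family witnesses that restricting relations to the coordinates in \<open>D\<close> is onto.
\<close>

definition dual_relations :: "nat set \<Rightarrow> (nat \<Rightarrow> nat \<Rightarrow> 'k) \<Rightarrow> bool" where
  "dual_relations D C \<longleftrightarrow> finite D \<and> D \<subseteq> {1..} \<and>
     (\<forall>d\<in>D. relation (C d) \<and> (\<forall>d'\<in>D. C d d' = (if d' = d then 1 else 0)))"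

lemma dual_relations_eval:
  assumes "dual_relations D C" "e \<in> D"
  shows "(\<Sum>d\<in>D. a d * C d e) = a e"
proof -
  have "(\<Sum>d\<in>D. a d * C d e) = (\<Sum>d\<in>D. if d = e then a e else 0)"
    using assms by (intro sum.cong) (auto simp: dual_relations_def)
  then show ?thesis using assms by (simp add: dual_relations_def)
qed

text \<open>
  Subtracting from the canonical coefficients of \<open>x\<close> the combination of dual relations that agrees
  with them on \<open>D\<close> leaves the sum unchanged and removes the vectors with index in \<open>D\<close>. Thus \<open>x\<close>
  is a limit of finite combinations of the other vectors.
\<close>

lemma dual_relations_imp_complete:
  assumes D: "dual_relations D C"
  shows "complete_set smul (f ` ({1..} - D))"
proof -
  have "x \<in> closure (span (f ` ({1..} - D)))" for x
  proof -
    define b where "b n = (\<Sum>d\<in>D. ip x (f d) * C d n)" for n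
    define a where "a n = ip x (f n) - b n" for n
    have "relation (\<lambda>n. 0 - b n)"
      unfolding b_def using D by (intro relation_sub_combination relation_zero) (auto simp: dual_relations_def)
    then have "((\<lambda>n. smul (ip x (f n)) (f n) + smul (0 - b n) (f n)) has_sum x + 0) {1..}"
      unfolding relation_def by (intro has_sum_add reconstruction) auto
    then have "((\<lambda>n. smul (a n) (f n)) has_sum x) {1..}"
      by (simp add: a_def scale_left_diff_distrib)
    moreover have "a d = 0" if "d \<in> D" for d
      using dual_relations_eval[OF D that] by (simp add: a_def b_def)
    ultimately have "((\<lambda>n. smul (a n) (f n)) has_sum x) ({1..} - D)"
      by (subst has_sum_cong_neutral[where T="{1..}" and g="\<lambda>n. smul (a n) (f n)"]) auto
    then have lim: "((\<lambda>F. \<Sum>n\<in>F. smul (a n) (f n)) \<longlongrightarrow> x) (finite_subsets_at_top ({1..} - D))"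
      by (simp add: has_sum_def)
    show ?thesis
    proof (rule Lim_in_closed_set[OF closed_closure _ _ lim])
      show "\<forall>\<^sub>F F in finite_subsets_at_top ({1..} - D).
          (\<Sum>n\<in>F. smul (a n) (f n)) \<in> closure (span (f ` ({1..} - D)))"
      proof (rule eventually_finite_subsets_at_top_weakI)
        fix F assume "finite F" "F \<subseteq> {1..} - D"
        then have "(\<Sum>n\<in>F. smul (a n) (f n)) \<in> span (f ` ({1..} - D))"
          by (intro span_sum span_scale span_base) auto
        then show "(\<Sum>n\<in>F. smul (a n) (f n)) \<in> closure (span (f ` ({1..} - D)))"
          using closure_subset by blast
      qed
    qed simp
  qed
  then show ?thesis unfolding complete_set_def by blast
qed

text \<open>
  One step of Gaussian elimination: a relation that vanishes on \<open>D\<close> with a nonzero entry at \<open>m\<close> is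
  scaled to have entry \<open>1\<close> there and then clears the entries of the old relations at \<open>m\<close>.
\<close>

lemma dual_relations_extend:
  assumes D: "dual_relations D C" and c: "relation c" "\<And>d. d \<in> D \<Longrightarrow> c d = 0"
    and m: "m \<in> {1..}" "c m \<noteq> 0"
  shows "\<exists>C'. dual_relations (insert m D) C'"
proof -
  have mD: "m \<notin> D" using c(2) m(2) by blast
  define c' where "c' n = inverse (c m) * c n" for n
  have c': "relation c'" "c' m = 1" "\<And>d. d \<in> D \<Longrightarrow> c' d = 0"
    unfolding c'_def using c m relation_scale[OF c(1)] by auto
  define C' where "C' d = (if d = m then c' else (\<lambda>n. C d n - C d m * c' n))" for d
  have "relation (C' d)" if "d \<in> insert m D" for d
    using that D c'(1) unfolding C'_def dual_relations_def
    by (auto intro!: relation_diff relation_scale)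
  then have "dual_relations (insert m D) C'"
    using D c' m(1) mD unfolding dual_relations_def by (auto simp: C'_def)
  then show ?thesis by blast
qed

text \<open>
  The sets with dual relations are deletable, so their size is bounded by the excess and one of
  maximal size exists. For it, the difference between a relation and its interpolation on \<open>D\<close> is a
  relation vanishing on \<open>D\<close>, and a nonzero entry of that difference would allow an extension of
  \<open>D\<close>.
\<close>

lemma finite_excess_imp_relations_determined:
  assumes "excess smul f < \<infinity>"
  obtains D C where "dual_relations D C"
    and "\<And>c n. relation c \<Longrightarrow> n \<in> {1..} \<Longrightarrow> c n = (\<Sum>d\<in>D. c d * C d n)"
proof -
  obtain M where M: "excess smul f = enat M" using assms by (cases "excess smul f") auto
  have le: "card D \<le> M" if "dual_relations D C" for D C
  proof -
    have "enat (card D) \<le> excess smul f"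
      unfolding excess_def
      using that dual_relations_imp_complete[OF that]
      by (intro Sup_upper) (auto simp: dual_relations_def)
    then show ?thesis by (simp add: M)
  qed
  define P where "P k \<longleftrightarrow> (\<exists>D C. dual_relations D C \<and> card D = k)" for k
  have "P 0" unfolding P_def by (rule exI[of _ "{}"]) (simp add: dual_relations_def)
  moreover have "\<forall>k. P k \<longrightarrow> k \<le> M" using le by (auto simp: P_def)
  ultimately obtain k where "P k" and max: "\<And>j. P j \<Longrightarrow> j \<le> k"
    using GreatestI_nat[of P 0 M] Greatest_le_nat[of P _ M] by blast
  then obtain D C where D: "dual_relations D C" "card D = k" by (auto simp: P_def)
  show thesis
  proof (rule that[OF D(1)])
    fix c and n :: nat assume c: "relation c" and n: "n \<in> {1..}"
    define r where "r i = c i - (\<Sum>d\<in>D. c d * C d i)" for i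
    have fin: "finite D" using D(1) by (simp add: dual_relations_def)
    have r: "relation r" unfolding r_def
      using c D(1) fin by (intro relation_sub_combination) (auto simp: dual_relations_def)
    have r0: "r d = 0" if "d \<in> D" for d
      using dual_relations_eval[OF D(1) that] by (simp add: r_def)
    have "r n = 0"
    proof (rule ccontr)
      assume "r n \<noteq> 0"
      then have "n \<notin> D" using r0 by blast
      obtain C' where "dual_relations (insert n D) C'"
        using dual_relations_extend[OF D(1) r r0 n \<open>r n \<noteq> 0\<close>] by blast
      then have "P (Suc k)" unfolding P_def using D(2) \<open>n \<notin> D\<close> fin
        by (intro exI[of _ "insert n D"] exI[of _ C']) simp
      then show False using max by fastforce
    qed
    then show "c n = (\<Sum>d\<in>D. c d * C d n)" by (simp add: r_def)
  qed
qed

section \<open>The defect of a coefficient sequence cut off to an index set\<close>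

text \<open>
  The left-hand side is \<open>\<langle>u, x - u\<rangle>\<close>. Expanding \<open>u\<close> pairs the coefficients of \<open>x\<close> on \<open>K\<close> with those of
  \<open>x - u\<close>, which on \<open>K\<close> agree with the relation \<open>r\<close>. Since \<open>r\<close> is the combination of the \<open>C d\<close>
  with coefficients \<open>r d\<close>, and \<open>|r d| \<le> \<parallel>x\<parallel>\<close>, each \<open>d \<in> D\<close> contributes at most \<open>\<parallel>x\<parallel> * (\<parallel>x\<parallel> * \<delta>)\<close>.
\<close>

lemma defect_bound:
  fixes \<delta> :: real
  assumes D: "dual_relations D C"
    and determined: "\<And>c n. relation c \<Longrightarrow> n \<in> {1..} \<Longrightarrow> c n = (\<Sum>d\<in>D. c d * C d n)"
    and K: "K \<subseteq> {1..}" "D \<inter> K = {}"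
    and small: "\<And>d F. d \<in> D \<Longrightarrow> finite F \<Longrightarrow> F \<subseteq> K \<Longrightarrow> (\<Sum>n\<in>F. (norm (C d n))\<^sup>2) \<le> \<delta>\<^sup>2"
    and "\<delta> \<ge> 0"
    and B: "((\<lambda>n. (norm (ip x (f n)))\<^sup>2) has_sum B) K"
    and u: "((\<lambda>n. smul (ip x (f n)) (f n)) has_sum u) K"
  shows "B - (norm u)\<^sup>2 \<le> card D * \<delta> * (norm x)\<^sup>2"
proof -
  have B_le: "B \<le> (norm x)\<^sup>2" by (rule has_sum_mono2[OF B analysis_has_sum K(1)]) simp
  have u_le: "(norm u)\<^sup>2 \<le> (norm x)\<^sup>2" using synthesis_bound[OF B u K(1)] B_le by linarith
  define c where "c n = (if n \<in> K then ip x (f n) else 0)" for n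
  define r where "r n = c n - ip u (f n)" for n
  have r: "relation r"
  proof -
    have "((\<lambda>n. (norm (c n))\<^sup>2) has_sum B) {1..}"
      using B by (subst has_sum_cong_neutral[where T=K and g="\<lambda>n. (norm (ip x (f n)))\<^sup>2"])
        (use K(1) in \<open>auto simp: c_def\<close>)
    moreover have "((\<lambda>n. smul (c n) (f n)) has_sum u) {1..}"
      using u by (subst has_sum_cong_neutral[where T=K and g="\<lambda>n. smul (ip x (f n)) (f n)"])
        (use K(1) in \<open>auto simp: c_def\<close>)
    then have "((\<lambda>n. smul (c n) (f n) + - smul (ip u (f n)) (f n)) has_sum u + - u) {1..}"
      by (rule has_sum_add) (use reconstruction[of u] in \<open>simp add: has_sum_uminus\<close>)
    ultimately show ?thesis
      using summable_on_norm_sq_diff[OF has_sum_imp_summable has_sum_imp_summable[OF analysis_has_sum[of u]], of c]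
      unfolding relation_def r_def by (auto simp: scale_left_diff_distrib)
  qed
  have r_on_K: "ip (x - u) (f n) = r n" if "n \<in> K" for n
    using that by (simp add: r_def c_def ip_diff_left)
  have r_on_D: "norm (r d) \<le> norm x" if "d \<in> D" for d
  proof -
    have "d \<in> {1..}" "d \<notin> K" using that D K unfolding dual_relations_def by auto
    then have "(norm (r d))\<^sup>2 \<le> (norm u)\<^sup>2"
      using finite_sum_le_has_sum[OF analysis_has_sum[of u], of "{d}"] by (simp add: r_def c_def)
    then have "(norm (r d))\<^sup>2 \<le> (norm x)\<^sup>2" using u_le by linarith
    then show ?thesis by (rule power2_le_imp_le) simp
  qed
  have "norm (ip u (x - u)) \<le> card D * \<delta> * (norm x)\<^sup>2"
  proof (rule has_sum_norm_le[OF ip_synthesis[OF u]])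
    fix F assume F: "finite F" "F \<subseteq> K"
    have c_le: "(\<Sum>n\<in>F. (norm (ip x (f n)))\<^sup>2) \<le> (norm x)\<^sup>2"
      using F K(1) by (intro finite_sum_le_has_sum[OF analysis_has_sum]) auto
    have "norm (\<Sum>n\<in>F. ip x (f n) * conjugate (ip (x - u) (f n)))
        \<le> (\<Sum>n\<in>F. norm (ip x (f n)) * norm (r n))"
      using F(2) by (intro sum_norm_le) (auto simp: norm_mult r_on_K)
    also have "\<dots> \<le> (\<Sum>n\<in>F. \<Sum>d\<in>D. norm x * (norm (ip x (f n)) * norm (C d n)))"
    proof (rule sum_mono)
      fix n assume "n \<in> F"
      then have "r n = (\<Sum>d\<in>D. r d * C d n)" using determined[OF r] F K by blast
      then have "norm (r n) \<le> (\<Sum>d\<in>D. norm (r d) * norm (C d n))"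
        using norm_sum[of "\<lambda>d. r d * C d n" D] by (simp add: norm_mult)
      also have "\<dots> \<le> (\<Sum>d\<in>D. norm x * norm (C d n))"
        by (intro sum_mono mult_right_mono r_on_D) auto
      finally have "norm (ip x (f n)) * norm (r n)
          \<le> norm (ip x (f n)) * (\<Sum>d\<in>D. norm x * norm (C d n))"
        by (rule mult_left_mono) simp
      then show "norm (ip x (f n)) * norm (r n)
          \<le> (\<Sum>d\<in>D. norm x * (norm (ip x (f n)) * norm (C d n)))"
        by (simp add: sum_distrib_left mult_ac)
    qed
    also have "\<dots> = (\<Sum>d\<in>D. norm x * (\<Sum>n\<in>F. norm (ip x (f n)) * norm (C d n)))"
      by (subst sum.swap) (simp add: sum_distrib_left)
    also have "\<dots> \<le> (\<Sum>d\<in>D. norm x * (norm x * \<delta>))"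
      using F \<open>\<delta> \<ge> 0\<close> by (intro sum_mono mult_left_mono sum_norm_mult_le c_le small) auto
    also have "\<dots> = card D * \<delta> * (norm x)\<^sup>2" by (simp add: power2_eq_square)
    finally show "norm (\<Sum>n\<in>F. ip x (f n) * conjugate (ip (x - u) (f n)))
        \<le> card D * \<delta> * (norm x)\<^sup>2" .
  qed
  moreover have "ip u (x - u) = of_real (B - (norm u)\<^sup>2)"
    by (simp add: ip_diff_right ip_self ip_synthesis_analysis[OF B u])
  ultimately show ?thesis by (simp only: norm_of_real)
qed

text \<open>
  Both identities come from \<open>A + B = \<parallel>x\<parallel>\<^sup>2\<close> and \<open>v = x - u\<close> together with \<open>\<langle>u, x\<rangle> = B\<close>, which gives
  \<open>\<parallel>x - u\<parallel>\<^sup>2 = \<parallel>x\<parallel>\<^sup>2 - 2 * B + \<parallel>u\<parallel>\<^sup>2\<close>.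
\<close>

lemma energy_plus_complementary_norm:
  assumes "J \<subseteq> {1..}" and K: "K = {1..} - J"
    and A: "((\<lambda>n. (norm (ip x (f n)))\<^sup>2) has_sum A) J"
    and B: "((\<lambda>n. (norm (ip x (f n)))\<^sup>2) has_sum B) K"
    and v: "((\<lambda>n. smul (ip x (f n)) (f n)) has_sum v) J"
    and u: "((\<lambda>n. smul (ip x (f n)) (f n)) has_sum u) K"
  shows "A + (norm u)\<^sup>2 = (norm x)\<^sup>2 - (B - (norm u)\<^sup>2)"
    and "B + (norm v)\<^sup>2 = (norm x)\<^sup>2 - (B - (norm u)\<^sup>2)"
proof -
  have "A = (norm x)\<^sup>2 - B" "v = x - u"
    using has_sum_Diff[OF analysis_has_sum[of x] A assms(1)] B
      has_sum_Diff[OF reconstruction[of x] v assms(1)] u has_sum_unique unfolding K by force+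
  moreover have "(norm (x - u))\<^sup>2 = (norm x)\<^sup>2 - B - B + (norm u)\<^sup>2"
  proof -
    have "(of_real ((norm (x - u))\<^sup>2) :: 'k) = of_real ((norm x)\<^sup>2 - B - B + (norm u)\<^sup>2)"
      by (subst norm_diff_square) (simp add: ip_synthesis_analysis[OF B u])
    then show ?thesis using of_real_eq_iff by blast
  qed
  ultimately show "A + (norm u)\<^sup>2 = (norm x)\<^sup>2 - (B - (norm u)\<^sup>2)"
    and "B + (norm v)\<^sup>2 = (norm x)\<^sup>2 - (B - (norm u)\<^sup>2)" by auto
qed

section \<open>Uniform lower bounds for frames of finite excess\<close>

lemma finite_excess_uniform_lower_bounds:
  assumes "excess smul f < \<infinity>" and "\<epsilon> > 0"
  shows "\<exists>n\<^sub>0\<ge>1. \<forall>J. {1..n\<^sub>0} \<subseteq> J \<and> J \<subseteq> {1..} \<longrightarrow>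
    (\<forall>x. x \<noteq> 0 \<longrightarrow>
      (\<Sum>\<^sub>\<infinity>n\<in>J. (norm (ip x (f n)))\<^sup>2)
        + (norm (\<Sum>\<^sub>\<infinity>n\<in>{1..} - J. smul (ip x (f n)) (f n)))\<^sup>2
      > (1 - \<epsilon>) * (norm x)\<^sup>2) \<and>
    (\<forall>x. x \<noteq> 0 \<longrightarrow>
      (\<Sum>\<^sub>\<infinity>n\<in>{1..} - J. (norm (ip x (f n)))\<^sup>2)
        + (norm (\<Sum>\<^sub>\<infinity>n\<in>J. smul (ip x (f n)) (f n)))\<^sup>2
      > (1 - \<epsilon>) * (norm x)\<^sup>2)"
proof -
  obtain D C where D: "dual_relations D C"
    and determined: "\<And>c n. relation c \<Longrightarrow> n \<in> {1..} \<Longrightarrow> c n = (\<Sum>d\<in>D. c d * C d n)"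
    using finite_excess_imp_relations_determined[OF assms(1)] by blast
  have finD: "finite D" using D by (simp add: dual_relations_def)
  \<comment> \<open>The summand \<open>1\<close> covers the case that \<open>D\<close> is empty and makes \<open>card D * \<delta> < \<epsilon>\<close> strict.\<close>
  define \<delta> where "\<delta> = \<epsilon> / (card D + 1)"
  have \<delta>: "\<delta> > 0" "card D * \<delta> < \<epsilon>" using \<open>\<epsilon> > 0\<close> by (simp_all add: \<delta>_def field_simps)
  define g where "g n = (\<Sum>d\<in>D. (norm (C d n))\<^sup>2)" for n
  have "(\<lambda>n. \<Sum>d\<in>E. (norm (C d n))\<^sup>2) summable_on {1..}" if "finite E" "E \<subseteq> D" for E
    using that
  proof (induction E rule: finite_induct)
    case (insert d E)
    have "(\<lambda>n. (norm (C d n))\<^sup>2) summable_on {1..}"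
      using insert.prems D by (auto simp: dual_relations_def relation_def)
    then show ?case using insert by (simp add: summable_on_add)
  qed simp
  then have g: "g summable_on {1..}" unfolding g_def using finD by blast
  have g0: "g n \<ge> 0" for n by (simp add: g_def sum_nonneg)
  obtain N where N: "\<And>K. K \<subseteq> {Suc N..} \<Longrightarrow> infsum g K < \<delta>\<^sup>2"
    using tail_sum_less[OF g g0, of "\<delta>\<^sup>2"] \<delta>(1) by auto
  \<comment> \<open>The initial segment has to contain \<open>D\<close>, so that the complement of \<open>J\<close> is disjoint
    from \<open>D\<close>, as well as all indices up to \<open>N\<close>.\<close>
  define n\<^sub>0 where "n\<^sub>0 = Max (insert 1 (insert N D))"
  have n\<^sub>0: "1 \<le> n\<^sub>0" "N \<le> n\<^sub>0" "\<And>d. d \<in> D \<Longrightarrow> d \<le> n\<^sub>0"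
    unfolding n\<^sub>0_def using finD by (blast intro: Max_ge)+
  have "(\<Sum>\<^sub>\<infinity>n\<in>J. (norm (ip x (f n)))\<^sup>2)
        + (norm (\<Sum>\<^sub>\<infinity>n\<in>{1..} - J. smul (ip x (f n)) (f n)))\<^sup>2
      > (1 - \<epsilon>) * (norm x)\<^sup>2"
    "(\<Sum>\<^sub>\<infinity>n\<in>{1..} - J. (norm (ip x (f n)))\<^sup>2)
        + (norm (\<Sum>\<^sub>\<infinity>n\<in>J. smul (ip x (f n)) (f n)))\<^sup>2
      > (1 - \<epsilon>) * (norm x)\<^sup>2"
    if J: "{1..n\<^sub>0} \<subseteq> J" "J \<subseteq> {1..}" and "x \<noteq> 0" for J x
  proof -
    define K where "K = {1..} - J"
    have K: "K \<subseteq> {1..}" by (auto simp: K_def)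
    have K_tail: "K \<subseteq> {Suc N..}"
    proof
      fix n assume "n \<in> K"
      then have "\<not> n \<le> n\<^sub>0" using J(1) by (auto simp: K_def)
      then show "n \<in> {Suc N..}" using n\<^sub>0(2) by simp
    qed
    have "D \<subseteq> {1..n\<^sub>0}" using D n\<^sub>0(3) unfolding dual_relations_def by auto
    then have "D \<subseteq> J" using J(1) by simp
    then have DK: "D \<inter> K = {}" by (auto simp: K_def)
    have small: "(\<Sum>n\<in>F. (norm (C d n))\<^sup>2) \<le> \<delta>\<^sup>2" if "d \<in> D" "finite F" "F \<subseteq> K" for d F
    proof -
      have "(\<Sum>n\<in>F. (norm (C d n))\<^sup>2) \<le> sum g F"
        unfolding g_def using that(1) finD
        by (intro sum_mono member_le_sum[where f="\<lambda>d. (norm (C d _))\<^sup>2"]) auto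
      also have "\<dots> \<le> infsum g K"
        using that g0 by (intro finite_sum_le_infsum summable_on_subset_banach[OF g K]) auto
      finally show ?thesis using N[OF K_tail] by linarith
    qed
    have energy: "((\<lambda>n. (norm (ip x (f n)))\<^sup>2) has_sum (\<Sum>\<^sub>\<infinity>n\<in>S. (norm (ip x (f n)))\<^sup>2)) S"
      if "S \<subseteq> {1..}" for S
      by (intro has_sum_infsum summable_on_subset_banach[OF has_sum_imp_summable[OF analysis_has_sum] that])
    have synth: "((\<lambda>n. smul (ip x (f n)) (f n)) has_sum (\<Sum>\<^sub>\<infinity>n\<in>S. smul (ip x (f n)) (f n))) S"
      if "S \<subseteq> {1..}" for S
      using energy[OF that] that
      by (intro has_sum_infsum synthesis_summable) (auto simp: summable_on_def)
    have "card D * \<delta> * (norm x)\<^sup>2 < \<epsilon> * (norm x)\<^sup>2"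
      using \<delta>(2) \<open>x \<noteq> 0\<close> by simp
    moreover note defect_bound[OF D determined K DK small less_imp_le[OF \<delta>(1)] energy[OF K] synth[OF K]]
    moreover note energy_plus_complementary_norm[OF J(2) K_def energy[OF J(2)] energy[OF K] synth[OF J(2)] synth[OF K]]
    ultimately show "(\<Sum>\<^sub>\<infinity>n\<in>J. (norm (ip x (f n)))\<^sup>2)
        + (norm (\<Sum>\<^sub>\<infinity>n\<in>{1..} - J. smul (ip x (f n)) (f n)))\<^sup>2
      > (1 - \<epsilon>) * (norm x)\<^sup>2"
      and "(\<Sum>\<^sub>\<infinity>n\<in>{1..} - J. (norm (ip x (f n)))\<^sup>2)
        + (norm (\<Sum>\<^sub>\<infinity>n\<in>J. smul (ip x (f n)) (f n)))\<^sup>2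
      > (1 - \<epsilon>) * (norm x)\<^sup>2"
      unfolding K_def left_diff_distrib by linarith+
  qed
  then show ?thesis using n\<^sub>0(1) by blast
qed

end

theorem corollary2p11:
  fixes smul :: "'k::hilbert_scalar \<Rightarrow> 'a::banach \<Rightarrow> 'a"
    and ip :: "'a \<Rightarrow> 'a \<Rightarrow> 'k"
    and f :: "nat \<Rightarrow> 'a"
    and \<epsilon> :: real
  assumes "hilbert_space smul ip"
    and "separable_space (euclidean :: 'a topology)"
    and "infinite_dimensional smul"
    and "parseval_frame ip f"
    and "excess smul f < \<infinity>"
    and "\<epsilon> > 0"
  shows "\<exists>n\<^sub>0\<ge>1. \<forall>J. {1..n\<^sub>0} \<subseteq> J \<and> J \<subseteq> {1..} \<longrightarrow>
    (\<forall>x. x \<noteq> 0 \<longrightarrow>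
      (\<Sum>\<^sub>\<infinity>n\<in>J. (norm (ip x (f n)))\<^sup>2)
        + (norm (\<Sum>\<^sub>\<infinity>n\<in>{1..} - J. smul (ip x (f n)) (f n)))\<^sup>2
      > (1 - \<epsilon>) * (norm x)\<^sup>2) \<and>
    (\<forall>x. x \<noteq> 0 \<longrightarrow>
      (\<Sum>\<^sub>\<infinity>n\<in>{1..} - J. (norm (ip x (f n)))\<^sup>2)
        + (norm (\<Sum>\<^sub>\<infinity>n\<in>J. smul (ip x (f n)) (f n)))\<^sup>2
      > (1 - \<epsilon>) * (norm x)\<^sup>2)"
proof -
  interpret parseval_frame_space smul ip f
    using assms(1,4) by (simp add: parseval_frame_space_def parseval_frame_space_axioms_def)
  show ?thesis using assms(5,6) by (rule finite_excess_uniform_lower_bounds)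
qed

end
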